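(* Let $G$ be an interval graph, $c\ge 1$ and $k\ge 0$ integers, and let $S$ and $S'$ be distinct $c$-colorable sets of size at least $k$ in $G$. Suppose neither $S$ nor $S'$ is locked in $G$. Then $d := \mathrm{dist}_{\mathsf{TAR}_k}(S,S')$ in $G$ is determined as follows. (1) If neither $S$ nor $S'$ is locked in $G[S \cup S']$, then $d = |S \triangle S'|$. (2) If exactly one of $S$ and $S'$ is locked in $G[S \cup S']$, then $d = |S \triangle S'| + 2$. (3) If both $S$ and $S'$ are locked in $G[S \cup S']$, then: (a) if there is a vertex $v \in V(G) \setminus (S \cup S')$ such that both $S \cup \{v\}$ and $S' \cup \{v\}$ are $c$-colorable in $G$, then $d = |S \triangle S'| + 2$; (b) otherwise $d = |S \triangle S'| + 4$.
   Context: A set $S \subseteq V(H)$ of a graph $H$ is $c$-colorable if $H[S]$ has a proper $c$-coloring. For $c$-colorable sets $S,T$ of $G$, $S \leftrightarrow T$ under $\mathsf{TAR}_k$ means $|S|,|T|\ge k$ and $|S\triangle T|=1$. A $\mathsf{TAR}_k$-sequence of length $\ell$ between $S_0$ and $S_\ell$ is a sequence $\langle S_0,\dots,S_\ell\rangle$ of $c$-colorable sets of $G$ with $S_{i-1}\leftrightarrow S_i$ under $\mathsf{TAR}_k$ for all $i$; $\mathrm{dist}_{\mathsf{TAR}_k}(S,S')$ is the minimum length of such a sequence between $S$ and $S'$ in $G$ ($\infty$ if none exists). For a subgraph $H$ of $G$ (here $H = G$ or $H = G[S\cup S']$), a $c$-colorable set $S \subseteq V(H)$ is locked in $H$ if $S$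 is an inclusion-maximal $c$-colorable set of $H$ and $|S| = k$. An interval graph is the intersection graph of a family of closed intervals on the real line. *)

theory Defs
  imports Complex_Main "HOL-Library.Extended_Nat"
begin

record 'a ugraph =
  uverts :: "'a set"
  uedges :: "'a set set"

definition finite_simple_graph :: "'a ugraph \<Rightarrow> bool" where
  "finite_simple_graph G \<longleftrightarrow>
     finite (uverts G) \<and> (\<forall>e\<in>uedges G. e \<subseteq> uverts G \<and> card e = 2)"

definition induced_subgraph :: "'a ugraph \<Rightarrow> 'a set \<Rightarrow> 'a ugraph" where
  "induced_subgraph G W =
     \<lparr>uverts = uverts G \<inter> W, uedges = {e \<in> uedges G. e \<subseteq> W}\<rparr>"

text \<open>The vertices index the family, so distinct vertices may carry the same set.\<close>

definition intersection_graph :: "'a set \<Rightarrow> ('a \<Rightarrow> 'b set) \<Rightarrow> 'a ugraph" where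
  "intersection_graph V F =
     \<lparr>uverts = V, uedges = {{u, v} | u v. u \<in> V \<and> v \<in> V \<and> u \<noteq> v \<and> F u \<inter> F v \<noteq> {}}\<rparr>"

definition interval_graph :: "'a ugraph \<Rightarrow> bool" where
  "interval_graph G \<longleftrightarrow>
     (\<exists>l r :: 'a \<Rightarrow> real. (\<forall>v\<in>uverts G. l v \<le> r v) \<and>
        G = intersection_graph (uverts G) (\<lambda>v. {l v..r v}))"

definition proper_coloring :: "'a ugraph \<Rightarrow> nat \<Rightarrow> ('a \<Rightarrow> nat) \<Rightarrow> bool" where
  "proper_coloring G c f \<longleftrightarrow>
     (\<forall>v\<in>uverts G. f v < c) \<and>
     (\<forall>u\<in>uverts G. \<forall>v\<in>uverts G. {u, v} \<in> uedges G \<longrightarrow> f u \<noteq> f v)"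

definition colorable_set :: "'a ugraph \<Rightarrow> nat \<Rightarrow> 'a set \<Rightarrow> bool" where
  "colorable_set G c S \<longleftrightarrow>
     S \<subseteq> uverts G \<and> (\<exists>f. proper_coloring (induced_subgraph G S) c f)"

definition tar_adj :: "'a ugraph \<Rightarrow> nat \<Rightarrow> nat \<Rightarrow> 'a set \<Rightarrow> 'a set \<Rightarrow> bool" where
  "tar_adj G c k S T \<longleftrightarrow>
     colorable_set G c S \<and> colorable_set G c T \<and>
     card S \<ge> k \<and> card T \<ge> k \<and> card (sym_diff S T) = 1"

text \<open>A sequence of length \<open>n\<close> has \<open>n\<close> steps, hence \<open>n + 1\<close> members.\<close>

definition tar_sequence ::
  "'a ugraph \<Rightarrow> nat \<Rightarrow> nat \<Rightarrow> nat \<Rightarrow> 'a set list \<Rightarrow> 'a set \<Rightarrow> 'a set \<Rightarrow> bool" where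
  "tar_sequence G c k n Xs S T \<longleftrightarrow>
     length Xs = n + 1 \<and> Xs ! 0 = S \<and> Xs ! n = T \<and>
     (\<forall>i\<le>n. colorable_set G c (Xs ! i)) \<and>
     (\<forall>i<n. tar_adj G c k (Xs ! i) (Xs ! (i + 1)))"

text \<open>In \<^typ>\<open>enat\<close> the infimum of a nonempty set is its minimum, and that of the empty set is \<open>\<infinity>\<close>.\<close>

definition tar_dist :: "'a ugraph \<Rightarrow> nat \<Rightarrow> nat \<Rightarrow> 'a set \<Rightarrow> 'a set \<Rightarrow> enat" where
  "tar_dist G c k S T = Inf {enat n | n. \<exists>Xs. tar_sequence G c k n Xs S T}"

definition locked :: "'a ugraph \<Rightarrow> nat \<Rightarrow> nat \<Rightarrow> 'a set \<Rightarrow> bool" where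
  "locked H c k S \<longleftrightarrow>
     colorable_set H c S \<and> (\<forall>T. colorable_set H c T \<and> S \<subseteq> T \<longrightarrow> T = S) \<and> card S = k"

end

theory Submission
  imports Defs
begin

text \<open>
  An interval graph is perfect, so a set of vertices is \<open>c\<close>-colorable iff no point of the line lies in
  more than \<open>c\<close> of its intervals. This gives an exchange property: if \<open>x\<close> has the smallest right
  endpoint in \<open>A \<triangle> B\<close>, lies in \<open>B\<close>, and \<open>a\<close> has the smallest left endpoint in \<open>A - B\<close>, then
  \<open>A - {a} \<union> {x}\<close> is \<open>c\<close>-colorable, since \<open>a\<close> covers every point of the interval of \<open>x\<close> at which
  \<open>A\<close> is saturated. Hence two \<open>c\<close>-colorable sets with more than \<open>k\<close> elements are joined by a sequence
  of length \<open>|A \<triangle> B|\<close>. A set that is locked in \<open>G[S \<union> S']\<close> but not in \<open>G\<close> must first gain a vertex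
  outside \<open>S \<union> S'\<close>, which costs two extra steps, unless both ends are locked and share this vertex.
\<close>

section \<open>Colorable sets\<close>

lemma colorable_set_iff:
  "colorable_set G c S \<longleftrightarrow> S \<subseteq> uverts G \<and>
     (\<exists>f. (\<forall>v\<in>S. f v < c) \<and> (\<forall>u\<in>S. \<forall>v\<in>S. {u, v} \<in> uedges G \<longrightarrow> f u \<noteq> f v))"
proof (cases "S \<subseteq> uverts G")
  case True
  have "proper_coloring (induced_subgraph G S) c f \<longleftrightarrow>
      (\<forall>v\<in>S. f v < c) \<and> (\<forall>u\<in>S. \<forall>v\<in>S. {u, v} \<in> uedges G \<longrightarrow> f u \<noteq> f v)" for f
    unfolding proper_coloring_def induced_subgraph_def using True by (simp add: Int_absorb1)
  then show ?thesis unfolding colorable_set_def by (intro conj_cong[OF refl] ex_cong1)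
qed (simp add: colorable_set_def)

lemma colorable_set_mono:
  assumes "colorable_set G c T" "S \<subseteq> T"
  shows "colorable_set G c S"
proof -
  obtain f where f: "T \<subseteq> uverts G" "\<forall>v\<in>T. f v < c"
    "\<forall>u\<in>T. \<forall>v\<in>T. {u, v} \<in> uedges G \<longrightarrow> f u \<noteq> f v"
    using assms(1) unfolding colorable_set_iff by blast
  have "S \<subseteq> uverts G" "\<forall>v\<in>S. f v < c" using f assms(2) by blast+
  moreover have "\<forall>u\<in>S. \<forall>v\<in>S. {u, v} \<in> uedges G \<longrightarrow> f u \<noteq> f v"
    using f(3) assms(2) by (meson subsetD)
  ultimately show ?thesis unfolding colorable_set_iff by blast
qed

lemma colorable_set_induced_subgraph:
  "colorable_set (induced_subgraph G W) c S \<longleftrightarrow> colorable_set G c S \<and> S \<subseteq> W"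
proof (cases "S \<subseteq> W")
  case True
  then have "{u, v} \<subseteq> W" if "u \<in> S" "v \<in> S" for u v using that by blast
  then show ?thesis
    using True unfolding colorable_set_iff by (simp add: induced_subgraph_def cong: ball_cong)
qed (simp add: colorable_set_iff induced_subgraph_def)

text \<open>Colorability passes to subsets, so a colorable proper superset yields a colorable one
  with a single extra vertex. Maximality can therefore be tested one vertex at a time.\<close>

lemma locked_iff:
  assumes "colorable_set H c S"
  shows "locked H c k S \<longleftrightarrow>
    card S = k \<and> (\<forall>v\<in>uverts H - S. \<not> colorable_set H c (insert v S))"
proof -
  have "T = S" if "\<forall>v\<in>uverts H - S. \<not> colorable_set H c (insert v S)"
    "colorable_set H c T" "S \<subseteq> T" for T
  proof (rule ccontr)
    assume "T \<noteq> S"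
    with that(3) obtain v where v: "v \<in> T" "v \<notin> S" by blast
    then have "v \<in> uverts H" using that unfolding colorable_set_iff by blast
    moreover have "colorable_set H c (insert v S)"
      using v that by (auto intro: colorable_set_mono)
    ultimately show False using that v by blast
  qed
  then show ?thesis using assms unfolding locked_def by blast
qed

lemma locked_induced_subgraph_iff:
  assumes "colorable_set G c S" "colorable_set G c S'"
  shows "locked (induced_subgraph G (S \<union> S')) c k S \<longleftrightarrow>
    card S = k \<and> (\<forall>v\<in>S' - S. \<not> colorable_set G c (insert v S))"
proof -
  have "uverts (induced_subgraph G (S \<union> S')) - S = S' - S"
    using assms by (auto simp: induced_subgraph_def colorable_set_iff)
  then show ?thesis
    using assms by (auto simp: locked_iff colorable_set_induced_subgraph)
qed

section \<open>Interval representations: colorability as a bound on point loads, and the exchange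
  property\<close>

lemma uedges_intersection_graph:
  "{u, v} \<in> uedges (intersection_graph V F) \<longleftrightarrow> u \<in> V \<and> v \<in> V \<and> u \<noteq> v \<and> F u \<inter> F v \<noteq> {}"
  unfolding intersection_graph_def by (auto simp: doubleton_eq_iff)

text \<open>Greedy coloring by left endpoints: set aside the interval \<open>x\<close> with the
  largest left endpoint and color the rest by induction. Every interval that meets the one of
  \<open>x\<close> starts no later, so it contains \<open>l x\<close>; hence the load bound at the
  single point \<open>l x\<close> limits the colors forbidden for \<open>x\<close>.\<close>

lemma interval_coloring:
  fixes l r :: "'a \<Rightarrow> real"
  assumes "finite S" "\<And>v. v \<in> S \<Longrightarrow> l v \<le> r v"
    and "\<And>p. card {v \<in> S. p \<in> {l v..r v}} \<le> c"
  shows "\<exists>f. (\<forall>v\<in>S. f v < c) \<and>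
    (\<forall>u\<in>S. \<forall>v\<in>S. u \<noteq> v \<and> {l u..r u} \<inter> {l v..r v} \<noteq> {} \<longrightarrow> f u \<noteq> f v)"
  using assms
proof (induction "card S" arbitrary: S)
  case 0
  then show ?case by auto
next
  case (Suc n)
  have "S \<noteq> {}" using Suc.hyps by auto
  then have "Max (l ` S) \<in> l ` S" using Suc.prems by simp
  then obtain x where x: "x \<in> S" "l x = Max (l ` S)" by auto
  have le: "l v \<le> l x" if "v \<in> S" for v using that x Suc.prems by simp
  have load: "card {v \<in> S - {x}. p \<in> {l v..r v}} \<le> c" for p
    by (rule order_trans[OF card_mono Suc.prems(3)[of p]]) (use Suc.prems in auto)
  have "n = card (S - {x})" using Suc.hyps(2) x Suc.prems(1) by simp
  then obtain f where f: "\<forall>v\<in>S - {x}. f v < c"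
    "\<forall>u\<in>S - {x}. \<forall>v\<in>S - {x}. u \<noteq> v \<and> {l u..r u} \<inter> {l v..r v} \<noteq> {} \<longrightarrow> f u \<noteq> f v"
    using Suc.hyps(1)[of "S - {x}"] Suc.prems load by auto
  \<comment> \<open>The interval of \<open>x\<close> itself counts towards the load at
    \<open>l x\<close>, so \<open>?N\<close> has fewer than \<open>c\<close> members and blocks
    fewer than \<open>c\<close> colors.\<close>
  let ?N = "{v \<in> S. l x \<in> {l v..r v}} - {x}"
  have "card (f ` ?N) \<le> card ?N" using Suc.prems by (intro card_image_le) auto
  also have "\<dots> < card {v \<in> S. l x \<in> {l v..r v}}"
    using x(1) Suc.prems(1,2) by (intro card_Diff1_less) auto
  also have "\<dots> \<le> c" by (rule Suc.prems)
  finally have "\<not> {..<c} \<subseteq> f ` ?N"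
    using card_mono[of "f ` ?N" "{..<c}"] Suc.prems(1) by fastforce
  then obtain i where i: "i < c" "i \<notin> f ` ?N" by auto
  have nb: "v \<in> ?N" if "v \<in> S" "v \<noteq> x" "{l x..r x} \<inter> {l v..r v} \<noteq> {}" for v
    using that le[of v] by auto
  show ?case
  proof (intro exI[of _ "f(x := i)"] conjI ballI impI)
    show "(f(x := i)) v < c" if "v \<in> S" for v using that f i by auto
  next
    fix u v assume *: "u \<in> S" "v \<in> S" "u \<noteq> v \<and> {l u..r u} \<inter> {l v..r v} \<noteq> {}"
    consider "u = x" | "v = x" | "u \<noteq> x" "v \<noteq> x" by blast
    then show "(f(x := i)) u \<noteq> (f(x := i)) v"
    proof cases
      case 1
      then have "v \<in> ?N" using nb[of v] * by blast
      then have "i \<noteq> f v" using i by blast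
      then show ?thesis using 1 * by auto
    next
      case 2
      then have "u \<in> ?N" using nb[of u] * by blast
      then have "i \<noteq> f u" using i by blast
      then show ?thesis using 2 * by auto
    next
      case 3
      then show ?thesis using f * by simp
    qed
  qed
qed

text \<open>Intervals through a common point are pairwise adjacent, so a proper coloring is
  injective on them. The converse is the greedy coloring.\<close>

lemma colorable_set_interval_iff:
  fixes l r :: "'a \<Rightarrow> real"
  assumes G: "G = intersection_graph V (\<lambda>v. {l v..r v})" and fin: "finite V"
    and lr: "\<And>v. v \<in> V \<Longrightarrow> l v \<le> r v"
  shows "colorable_set G c S \<longleftrightarrow> S \<subseteq> V \<and> (\<forall>p. card {v \<in> S. p \<in> {l v..r v}} \<le> c)"
proof
  assume "colorable_set G c S"
  then obtain f where f: "S \<subseteq> V" "\<forall>v\<in>S. f v < c"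
      "\<forall>u\<in>S. \<forall>v\<in>S. {u, v} \<in> uedges G \<longrightarrow> f u \<noteq> f v"
    unfolding colorable_set_iff by (auto simp: G intersection_graph_def)
  have "card {v \<in> S. p \<in> {l v..r v}} \<le> card {..<c}" for p
  proof (rule card_inj_on_le)
    show "inj_on f {v \<in> S. p \<in> {l v..r v}}"
    proof (rule inj_onI, rule ccontr)
      fix u v assume *: "u \<in> {v \<in> S. p \<in> {l v..r v}}" "v \<in> {v \<in> S. p \<in> {l v..r v}}"
        "f u = f v" "u \<noteq> v"
      then have "{u, v} \<in> uedges G" using f(1) unfolding G uedges_intersection_graph by blast
      then show False using f(3) * by blast
    qed
    show "f ` {v \<in> S. p \<in> {l v..r v}} \<subseteq> {..<c}" using f by auto
  qed simp
  then show "S \<subseteq> V \<and> (\<forall>p. card {v \<in> S. p \<in> {l v..r v}} \<le> c)" using f by simp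
next
  assume *: "S \<subseteq> V \<and> (\<forall>p. card {v \<in> S. p \<in> {l v..r v}} \<le> c)"
  moreover have "finite S" using * fin finite_subset by blast
  moreover have "l v \<le> r v" if "v \<in> S" for v using that * lr by blast
  ultimately obtain f where f: "\<forall>v\<in>S. f v < c"
    "\<forall>u\<in>S. \<forall>v\<in>S. u \<noteq> v \<and> {l u..r u} \<inter> {l v..r v} \<noteq> {} \<longrightarrow> f u \<noteq> f v"
    using interval_coloring[of S l r c] by blast
  have "S \<subseteq> uverts G" using * by (simp add: G intersection_graph_def)
  moreover have "\<forall>u\<in>S. \<forall>v\<in>S. {u, v} \<in> uedges G \<longrightarrow> f u \<noteq> f v"
    unfolding G uedges_intersection_graph using f(2) by blast
  ultimately show "colorable_set G c S" using f(1) unfolding colorable_set_iff by blast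
qed

lemma exchange:
  fixes l r :: "'a \<Rightarrow> real"
  assumes G: "G = intersection_graph V (\<lambda>v. {l v..r v})" and fin: "finite V"
    and lr: "\<And>v. v \<in> V \<Longrightarrow> l v \<le> r v"
    and A: "colorable_set G c A" and B: "colorable_set G c B"
    and x: "x \<in> B - A" "\<And>y. y \<in> sym_diff A B \<Longrightarrow> r x \<le> r y"
    and ne: "A - B \<noteq> {}"
  shows "\<exists>a\<in>A - B. colorable_set G c (insert x (A - {a}))"
proof -
  note iff = colorable_set_interval_iff[OF G fin lr]
  have AB: "A \<subseteq> V" "B \<subseteq> V" and cA: "card {v \<in> A. p \<in> {l v..r v}} \<le> c"
    and cB: "card {v \<in> B. p \<in> {l v..r v}} \<le> c" for p
    using A B iff by blast+
  have finAB: "finite A" "finite B" using AB fin finite_subset by blast+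
  have "Min (l ` (A - B)) \<in> l ` (A - B)" using finAB ne by (intro Min_in) auto
  then obtain a where a: "a \<in> A - B" "l a = Min (l ` (A - B))" by auto
  have le: "l a \<le> l v" if "v \<in> A - B" for v using that a finAB by simp
  have "card {v \<in> insert x (A - {a}). p \<in> {l v..r v}} \<le> c" for p
  proof (cases "p \<in> {l x..r x}")
    case False
    then have "{v \<in> insert x (A - {a}). p \<in> {l v..r v}} \<subseteq> {v \<in> A. p \<in> {l v..r v}}" by blast
    then have "card {v \<in> insert x (A - {a}). p \<in> {l v..r v}} \<le> card {v \<in> A. p \<in> {l v..r v}}"
      using finAB by (intro card_mono) auto
    then show ?thesis using cA[of p] by simp
  next
    case p: True
    let ?A = "{v \<in> A. p \<in> {l v..r v}}" and ?B = "{v \<in> B. p \<in> {l v..r v}}"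
    have fin': "finite ?A" "finite ?B" using finAB by auto
    show ?thesis
    proof (cases "card ?A < c")
      \<comment> \<open>Room is left at \<open>p\<close>, so adding \<open>x\<close> is harmless
        there whether or not \<open>a\<close> covers \<open>p\<close>.\<close>
      case True
      have "card {v \<in> insert x (A - {a}). p \<in> {l v..r v}} \<le> card (insert x ?A)"
        using fin' by (intro card_mono) auto
      also have "\<dots> \<le> c" using True card_insert_le_m1[of "Suc (card ?A)" ?A x] by simp
      finally show ?thesis .
    next
      case False
      \<comment> \<open>At a saturated point of the interval of \<open>x\<close>, the set
        \<open>B\<close> has \<open>x\<close> in addition to the members shared with
        \<open>A\<close>. If it also had all of \<open>?A\<close>, its load would exceed
        \<open>c\<close>.\<close>
      have "\<not> ?A \<subseteq> ?B"
      proof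
        assume "?A \<subseteq> ?B"
        moreover have "x \<in> ?B" "x \<notin> ?A" using x p by auto
        ultimately have "?A \<subset> ?B" by blast
        then have "card ?A < card ?B" using fin'(2) by (intro psubset_card_mono)
        then show False using False cB[of p] by simp
      qed
      then obtain a' where a': "a' \<in> A - B" "p \<in> {l a'..r a'}" by blast
      \<comment> \<open>The chain is \<open>l a\<close> \<le> \<open>l a'\<close> \<le>
        \<open>p\<close> \<le> \<open>r x\<close> \<le> \<open>r a\<close>: the choice of
        \<open>a\<close> gives the first inequality, that of \<open>x\<close> the last. One vertex
        \<open>a\<close> thus serves all saturated points, and trading it for \<open>x\<close> keeps
        the load.\<close>
      then have "p \<in> {l a..r a}" using le[of a'] x(2)[of a] a p by auto
      then have eq: "{v \<in> insert x (A - {a}). p \<in> {l v..r v}} = insert x (?A - {a})"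
        and aA: "a \<in> ?A"
        using p a by auto
      have "card (insert x (?A - {a})) = Suc (card (?A - {a}))"
        using x fin' by (intro card_insert_disjoint) auto
      also have "\<dots> = card ?A" by (rule card_Suc_Diff1[OF fin'(1) aA])
      finally show ?thesis unfolding eq using cA[of p] by simp
    qed
  qed
  moreover have "insert x (A - {a}) \<subseteq> V" using AB x by blast
  ultimately show ?thesis using a iff by blast
qed

section \<open>Sequences\<close>

declare relpowp.simps(2) [simp del]

text \<open>Relational powers replace lists from here on. Colorability of \<open>S\<close> is stated
  separately because for \<open>n = 0\<close> no adjacency supplies it.\<close>

lemma ex_tar_sequence_iff:
  "(\<exists>Xs. tar_sequence G c k n Xs S T) \<longleftrightarrow> colorable_set G c S \<and> (tar_adj G c k ^^ n) S T"
proof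
  assume "\<exists>Xs. tar_sequence G c k n Xs S T"
  then obtain Xs where "tar_sequence G c k n Xs S T" ..
  then show "colorable_set G c S \<and> (tar_adj G c k ^^ n) S T"
    unfolding tar_sequence_def relpowp_fun_conv by (auto intro!: exI[of _ "(!) Xs"])
next
  assume *: "colorable_set G c S \<and> (tar_adj G c k ^^ n) S T"
  then obtain f where f: "f 0 = S" "f n = T" "\<forall>i<n. tar_adj G c k (f i) (f (Suc i))"
    unfolding relpowp_fun_conv by blast
  have "colorable_set G c (f i)" if "i \<le> n" for i
    using that * f by (cases i) (auto simp: tar_adj_def)
  then have "tar_sequence G c k n (map f [0..<Suc n]) S T"
    unfolding tar_sequence_def using f by (auto simp del: upt_Suc)
  then show "\<exists>Xs. tar_sequence G c k n Xs S T" ..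
qed

lemma tar_dist_eqI:
  assumes "colorable_set G c S" "(tar_adj G c k ^^ d) S T"
    and "\<And>n. (tar_adj G c k ^^ n) S T \<Longrightarrow> d \<le> n"
  shows "tar_dist G c k S T = enat d"
  unfolding tar_dist_def ex_tar_sequence_iff
proof (rule antisym)
  show "Inf {enat n |n. colorable_set G c S \<and> (tar_adj G c k ^^ n) S T} \<le> enat d"
    using assms(1,2) by (intro Inf_lower) blast
  show "enat d \<le> Inf {enat n |n. colorable_set G c S \<and> (tar_adj G c k ^^ n) S T}"
    using assms(3) by (intro Inf_greatest) auto
qed

lemma tar_adj_commute: "tar_adj G c k S T \<longleftrightarrow> tar_adj G c k T S"
  unfolding tar_adj_def by (auto simp: Un_commute)

lemma relpowp_tar_adj_commute: "(tar_adj G c k ^^ n) S T \<Longrightarrow> (tar_adj G c k ^^ n) T S"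
proof (induction n arbitrary: S)
  case (Suc n)
  then obtain U where "tar_adj G c k S U" "(tar_adj G c k ^^ n) U T"
    by (meson relpowp_Suc_D2)
  then show ?case using Suc.IH tar_adj_commute by (meson relpowp_Suc_I)
qed auto

lemma tar_adjE:
  assumes "tar_adj G c k S T"
  obtains v where "v \<notin> S" "T = insert v S" | v where "v \<in> S" "T = S - {v}"
proof -
  have "card (sym_diff S T) = 1" using assms unfolding tar_adj_def by blast
  then obtain v where "sym_diff S T = {v}" by (rule card_1_singletonE)
  then have v: "v \<in> S \<longleftrightarrow> v \<notin> T" and nv: "\<And>x. x \<noteq> v \<Longrightarrow> x \<in> S \<longleftrightarrow> x \<in> T"
    by blast+
  show thesis
  proof (cases "v \<in> S")
    case True
    have "x \<in> T \<longleftrightarrow> x \<in> S - {v}" for x using v nv[of x] True by (cases "x = v") auto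
    then have "T = S - {v}" by (rule set_eqI)
    then show thesis using that True by blast
  next
    case False
    have "x \<in> T \<longleftrightarrow> x \<in> insert v S" for x using v nv[of x] False by (cases "x = v") auto
    then have "T = insert v S" by (rule set_eqI)
    then show thesis using that False by blast
  qed
qed

lemma tar_adj_insert:
  assumes "colorable_set G c (insert v S)" "v \<notin> S" "k \<le> card S" "finite S"
  shows "tar_adj G c k S (insert v S)"
proof -
  have "sym_diff S (insert v S) = {v}" using assms by blast
  then show ?thesis
    using assms colorable_set_mono[of G c "insert v S" S] by (auto simp: tar_adj_def)
qed

lemma card_sym_diff_insert:
  assumes "finite S" "finite T" "v \<notin> S"
  shows "v \<in> T \<Longrightarrow> Suc (card (sym_diff (insert v S) T)) = card (sym_diff S T)"
    and "v \<notin> T \<Longrightarrow> card (sym_diff (insert v S) T) = Suc (card (sym_diff S T))"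
proof -
  assume "v \<in> T"
  then have "sym_diff S T = insert v (sym_diff (insert v S) T)" "v \<notin> sym_diff (insert v S) T"
    using assms by auto
  then show "Suc (card (sym_diff (insert v S) T)) = card (sym_diff S T)"
    using assms by simp
next
  assume "v \<notin> T"
  then have "sym_diff (insert v S) T = insert v (sym_diff S T)" "v \<notin> sym_diff S T"
    using assms by auto
  then show "card (sym_diff (insert v S) T) = Suc (card (sym_diff S T))"
    using assms by simp
qed

lemma card_sym_diff_commute: "card (sym_diff S T) = card (sym_diff T S)"
  by (simp add: Un_commute)

lemma card_sym_diff_remove:
  assumes "finite S" "finite T" "v \<in> S"
  shows "v \<notin> T \<Longrightarrow> Suc (card (sym_diff (S - {v}) T)) = card (sym_diff S T)"
    and "v \<in> T \<Longrightarrow> card (sym_diff (S - {v}) T) = Suc (card (sym_diff S T))"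
proof -
  have "insert v (S - {v}) = S" "finite (S - {v})" "v \<notin> S - {v}" using assms by auto
  then show "v \<notin> T \<Longrightarrow> Suc (card (sym_diff (S - {v}) T)) = card (sym_diff S T)"
    and "v \<in> T \<Longrightarrow> card (sym_diff (S - {v}) T) = Suc (card (sym_diff S T))"
    using card_sym_diff_insert[of "S - {v}" T v] assms(2) by presburger+
qed

section \<open>The lower bound by symmetric difference and the sequences that attain it\<close>

locale finite_interval_graph =
  fixes G :: "'a ugraph" and c k :: nat
  assumes finite_verts: "finite (uverts G)" and interval: "interval_graph G"
begin

abbreviation col :: "'a set \<Rightarrow> bool" where "col \<equiv> colorable_set G c"
abbreviation reach :: "nat \<Rightarrow> 'a set \<Rightarrow> 'a set \<Rightarrow> bool" where
  "reach n \<equiv> tar_adj G c k ^^ n"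

lemma finite_col: "col S \<Longrightarrow> finite S"
  using finite_verts finite_subset unfolding colorable_set_iff by blast

text \<open>Each step inserts or deletes one vertex and so changes the size of the symmetric
  difference with \<open>T\<close> by exactly one.\<close>

lemma card_sym_diff_le_reach:
  assumes "reach n S T" "col T"
  shows "card (sym_diff S T) \<le> n"
  using assms(1)
proof (induction n arbitrary: S)
  case (Suc n)
  then obtain U where U: "tar_adj G c k S U" "reach n U T" by (meson relpowp_Suc_D2)
  then have fin: "finite S" "finite T"
    using finite_col assms by (auto simp: tar_adj_def)
  from Suc.IH[OF U(2)] have "card (sym_diff U T) \<le> n" .
  with U(1) show ?case
  proof (cases rule: tar_adjE)
    case (1 v)
    then show ?thesis
      using card_sym_diff_insert[OF fin, of v] \<open>card (sym_diff U T) \<le> n\<close>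
      by (cases "v \<in> T") auto
  next
    case (2 v)
    then show ?thesis
      using card_sym_diff_remove[OF fin, of v] \<open>card (sym_diff U T) \<le> n\<close>
      by (cases "v \<in> T") auto
  qed
qed auto

text \<open>The smallest right endpoint in the symmetric difference may belong to either set, and it
  is that vertex which enters the other set. Hence the disjunction.\<close>

lemma ex_exchange:
  assumes "col A" "col B" "A - B \<noteq> {}" "B - A \<noteq> {}"
  shows "(\<exists>b\<in>B - A. \<exists>a\<in>A - B. col (insert b (A - {a}))) \<or>
         (\<exists>a\<in>A - B. \<exists>b\<in>B - A. col (insert a (B - {b})))"
proof -
  obtain l r :: "'a \<Rightarrow> real" where lr: "\<And>v. v \<in> uverts G \<Longrightarrow> l v \<le> r v"
    and G: "G = intersection_graph (uverts G) (\<lambda>v. {l v..r v})"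
    using interval unfolding interval_graph_def by blast
  have fin: "finite (sym_diff A B)" using finite_col assms by blast
  then have "Min (r ` sym_diff A B) \<in> r ` sym_diff A B"
    using assms by (intro Min_in) auto
  then obtain x where x: "Min (r ` sym_diff A B) = r x" "x \<in> sym_diff A B" by (rule imageE)
  have le: "r x \<le> r y" if "y \<in> sym_diff A B" for y
    using that x fin by (metis Min_le finite_imageI imageI)
  show ?thesis
  proof (cases "x \<in> B - A")
    case True
    then show ?thesis
      using exchange[OF G finite_verts lr assms(1,2) True le assms(3)] by blast
  next
    case False
    then have "x \<in> A - B" using x by blast
    moreover have "r x \<le> r y" if "y \<in> sym_diff B A" for y using le that by blast
    ultimately show ?thesis
      using exchange[OF G finite_verts lr assms(2,1) _ _ assms(4)] by blast
  qed
qed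

text \<open>Deleting \<open>a\<close> before inserting \<open>b\<close> keeps the intermediate set
  colorable, as a subset of \<open>A\<close>. Its size is at least \<open>k\<close> because
  \<open>A\<close> has more than \<open>k\<close> elements. Both steps bring the set closer to
  \<open>B\<close>.\<close>

lemma reach_exchange:
  assumes "col A" "col B" "k < card A" "a \<in> A - B" "b \<in> B - A" "col (insert b (A - {a}))"
    and "reach (card (sym_diff (insert b (A - {a})) B)) (insert b (A - {a})) B"
  shows "reach (card (sym_diff A B)) A B"
proof -
  have fin: "finite A" "finite B" using finite_col assms by auto
  have c1: "card A = Suc (card (A - {a}))"
    using assms(4) fin(1) by (metis DiffD1 card_Suc_Diff1)
  have "tar_adj G c k (A - {a}) (insert a (A - {a}))"
    using assms c1 fin by (intro tar_adj_insert) (auto simp: insert_absorb)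
  then have "tar_adj G c k A (A - {a})"
    using assms(4) tar_adj_commute by (metis DiffD1 insert_Diff)
  moreover have "tar_adj G c k (A - {a}) (insert b (A - {a}))"
    using assms c1 fin by (intro tar_adj_insert) auto
  moreover have "card (sym_diff A B) = Suc (Suc (card (sym_diff (insert b (A - {a})) B)))"
    using card_sym_diff_insert(1)[of "A - {a}" B b] card_sym_diff_remove(1)[of A B a] assms fin
    by auto
  ultimately show ?thesis using assms(7) by (metis relpowp_Suc_I2)
qed

lemma reach_subset:
  assumes "col B" "A \<subseteq> B" "k \<le> card A"
  shows "reach (card (B - A)) A B"
  using assms(2,3)
proof (induction "card (B - A)" arbitrary: A)
  case 0
  then have "A = B" using finite_col[OF assms(1)] by auto
  then show ?case using 0 by auto
next
  case (Suc n)
  have fin: "finite A" "finite B" using Suc.prems finite_col[OF assms(1)] finite_subset by auto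
  obtain b where b: "b \<in> B - A" using Suc.hyps(2) by (metis card.empty nat.simps(3) ex_in_conv)
  have n: "n = card (B - insert b A)"
    using Suc.hyps(2) b fin by (metis Diff_insert card_Diff_singleton diff_Suc_1)
  have "reach (card (B - insert b A)) (insert b A) B"
  proof (rule Suc.hyps(1)[OF n])
    show "k \<le> card (insert b A)" using Suc.prems fin b by auto
  qed (use Suc.prems b in blast)
  moreover have "tar_adj G c k A (insert b A)"
    using b fin Suc.prems colorable_set_mono[OF assms(1), of "insert b A"]
    by (intro tar_adj_insert) auto
  ultimately show ?case using Suc.hyps(2) n by (metis relpowp_Suc_I2)
qed

text \<open>Induction on the size of the symmetric difference. An exchange preserves cardinality, so
  the strict bound needed for the next deletion survives.\<close>

lemma reach_of_less_card:
  assumes "col A" "col B" "k < card A" "k < card B"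
  shows "reach (card (sym_diff A B)) A B"
  using assms
proof (induction "card (sym_diff A B)" arbitrary: A B rule: less_induct)
  case less
  have fin: "finite A" "finite B" using finite_col less.prems by auto
  \<comment> \<open>Stated for \<open>C\<close> and \<open>D\<close> so that it covers an exchange
    at either end: it is used with \<open>A\<close>, \<open>B\<close> and with \<open>B\<close>,
    \<open>A\<close>.\<close>
  have *: "reach (card (sym_diff C D)) C D"
    if "sym_diff C D = sym_diff A B" "col C" "col D" "k < card C" "k < card D"
      "a \<in> C - D" "b \<in> D - C" "col (insert b (C - {a}))" for C D a b
  proof (rule reach_exchange[OF that(2-4) that(6-8)])
    have finC: "finite C" "finite D" using finite_col that by auto
    have "card (insert b (C - {a})) = card C"
      using that finC by (auto simp: card.remove)
    moreover have "card (sym_diff (insert b (C - {a})) D) < card (sym_diff A B)"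
      unfolding that(1)[symmetric]
      using card_sym_diff_insert(1)[of "C - {a}" D b] card_sym_diff_remove(1)[of C D a] that finC
      by auto
    moreover have "k < card (insert b (C - {a}))" using calculation that by simp
    ultimately show "reach (card (sym_diff (insert b (C - {a})) D)) (insert b (C - {a})) D"
      using less.hyps[of "insert b (C - {a})" D] that by blast
  qed
  consider "A \<subseteq> B" | "B \<subseteq> A" | "A - B \<noteq> {}" "B - A \<noteq> {}" by blast
  then show ?case
  proof cases
    case 1
    then have "sym_diff A B = B - A" by blast
    then show ?thesis using reach_subset[of B A] 1 less.prems by auto
  next
    case 2
    then have "sym_diff A B = A - B" by blast
    then show ?thesis
      using reach_subset[of A B] 2 less.prems relpowp_tar_adj_commute by auto
  next
    case 3
    from ex_exchange[OF less.prems(1,2) this] show ?thesis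
    proof
      assume "\<exists>b\<in>B - A. \<exists>a\<in>A - B. col (insert b (A - {a}))"
      then show ?thesis using *[of A B] less.prems by blast
    next
      assume "\<exists>a\<in>A - B. \<exists>b\<in>B - A. col (insert a (B - {b}))"
      then have "reach (card (sym_diff B A)) B A" using *[of B A] less.prems by blast
      then show ?thesis using relpowp_tar_adj_commute card_sym_diff_commute by metis
    qed
  qed
qed

lemma reach_insert:
  assumes "col A" "col (insert v A)" "v \<notin> A" "k \<le> card A" "reach n (insert v A) B"
  shows "reach (Suc n) A B"
  using relpowp_Suc_I2[OF tar_adj_insert[OF assms(2-4) finite_col[OF assms(1)]] assms(5)] .

text \<open>If \<open>B\<close> has only \<open>k\<close> elements, it is first enlarged by a vertex
  of \<open>A\<close>. That step also shrinks the symmetric difference by one, so nothing is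
  lost.\<close>

lemma reach_of_less_card_left:
  assumes "col A" "col B" "k < card A" "k \<le> card B"
    and "card B = k \<Longrightarrow> \<exists>a\<in>A - B. col (insert a B)"
  shows "reach (card (sym_diff A B)) A B"
proof (cases "k < card B")
  case True
  then show ?thesis using reach_of_less_card assms by blast
next
  case False
  then obtain a where a: "a \<in> A - B" "col (insert a B)" using assms by auto
  have fin: "finite A" "finite B" using finite_col assms by auto
  have "reach (card (sym_diff (insert a B) A)) (insert a B) A"
    using reach_of_less_card[of "insert a B" A] assms a fin by auto
  then have "reach (Suc (card (sym_diff (insert a B) A))) B A"
    using reach_insert a assms by blast
  then have "reach (card (sym_diff B A)) B A"
    using card_sym_diff_insert(1)[of B A a] a fin by auto
  then show ?thesis using relpowp_tar_adj_commute card_sym_diff_commute by metis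
qed

lemma reach_card_sym_diff:
  assumes "col A" "col B" "k \<le> card A" "k \<le> card B"
    and "card A = k \<Longrightarrow> \<exists>b\<in>B - A. col (insert b A)"
    and "card B = k \<Longrightarrow> \<exists>a\<in>A - B. col (insert a B)"
  shows "reach (card (sym_diff A B)) A B"
proof (cases "k < card A")
  case True
  then show ?thesis using reach_of_less_card_left assms by blast
next
  case False
  then obtain b where b: "b \<in> B - A" "col (insert b A)" using assms by auto
  have fin: "finite A" "finite B" using finite_col assms by auto
  have "reach (card (sym_diff (insert b A) B)) (insert b A) B"
    using reach_of_less_card_left[of "insert b A" B] assms b fin False by auto
  then have "reach (Suc (card (sym_diff (insert b A) B))) A B"
    using reach_insert b assms by blast
  then show ?thesis using card_sym_diff_insert(1)[of A B b] b fin by auto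
qed

section \<open>Sets whose first step must leave the union of both ends\<close>

text \<open>By \<open>locked_induced_subgraph_iff\<close>, for colorable \<open>A\<close> and
  \<open>B\<close> this is lockedness of \<open>A\<close> in the subgraph induced by the union of
  \<open>A\<close> and \<open>B\<close>.\<close>

definition stuck :: "'a set \<Rightarrow> 'a set \<Rightarrow> bool" where
  "stuck A B \<longleftrightarrow> card A = k \<and> (\<forall>v\<in>B - A. \<not> col (insert v A))"

text \<open>A deletion would go below \<open>k\<close>, and stuckness forbids inserting a vertex of
  \<open>B\<close>. So the first step brings in a vertex outside both sets.\<close>

lemma stuck_reachE:
  assumes "col A" "stuck A B" "A \<noteq> B" "reach n A B"
  obtains m v where "n = Suc m" "v \<in> uverts G - (A \<union> B)" "col (insert v A)"
    "reach m (insert v A) B"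
proof -
  obtain m where m: "n = Suc m" using assms by (cases n) auto
  then obtain T where T: "tar_adj G c k A T" "reach m T B" using assms by (meson relpowp_Suc_D2)
  from T(1) show thesis
  proof (cases rule: tar_adjE)
    case (1 v)
    then have "col (insert v A)" using T by (auto simp: tar_adj_def)
    then show thesis
      using that[OF m, of v] 1 T assms unfolding stuck_def colorable_set_iff by blast
  next
    case (2 v)
    then have "card T < card A" using finite_col assms by (metis card_Diff1_less)
    then show thesis using T assms by (auto simp: tar_adj_def stuck_def)
  qed
qed

text \<open>The forced first step costs one and also enlarges the symmetric difference by one, since
  the new vertex has to be deleted again. This gives the surplus of two in both bounds.\<close>

lemma tar_dist_one_stuck:
  assumes "col A" "col B" "A \<noteq> B" "k \<le> card B" "stuck A B" "\<not> stuck B A"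
    and "v \<in> uverts G - A" "col (insert v A)"
  shows "tar_dist G c k A B = enat (card (sym_diff A B) + 2)"
proof (rule tar_dist_eqI)
  have fin: "finite A" "finite B" using finite_col assms by auto
  have v: "v \<notin> A" "v \<notin> B" using assms by (auto simp: stuck_def)
  \<comment> \<open>Now the left end has \<open>k + 1\<close> elements. If \<open>B\<close> has
    \<open>k\<close>, then \<open>B\<close> not being stuck provides the vertex of \<open>A\<close>
    that can be added to it.\<close>
  have "reach (card (sym_diff (insert v A) B)) (insert v A) B"
    using assms v fin by (intro reach_of_less_card_left) (auto simp: stuck_def)
  then show "reach (card (sym_diff A B) + 2) A B"
    using reach_insert[of A v] assms v card_sym_diff_insert(2)[OF fin v]
    by (auto simp: stuck_def)
next
  fix n assume "reach n A B"
  then obtain m u where u: "n = Suc m" "u \<in> uverts G - (A \<union> B)" "reach m (insert u A) B"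
    using stuck_reachE[OF assms(1,5,3)] by metis
  then have "card (sym_diff (insert u A) B) \<le> m" using card_sym_diff_le_reach assms by blast
  then show "card (sym_diff A B) + 2 \<le> n"
    using card_sym_diff_insert(2)[of A B u] u finite_col assms by auto
qed (rule assms)

lemma tar_dist_commute:
  assumes "col A" "col B"
  shows "tar_dist G c k A B = tar_dist G c k B A"
proof -
  have "reach n A B \<longleftrightarrow> reach n B A" for n using relpowp_tar_adj_commute by blast
  then show ?thesis unfolding tar_dist_def ex_tar_sequence_iff using assms by simp
qed

text \<open>The first step is forced as seen from \<open>A\<close>, and the last one, read
  backwards, as seen from \<open>B\<close>.\<close>

lemma stuck_reach_stuckE:
  assumes "col A" "col B" "stuck A B" "stuck B A" "A \<noteq> B" "reach n A B"
  obtains m u v where "n = Suc (Suc m)" "u \<in> uverts G - (A \<union> B)" "v \<in> uverts G - (A \<union> B)"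
    "col (insert u A)" "col (insert v B)"
    "card (sym_diff (insert u A) (insert v B)) \<le> m"
proof -
  obtain m u where u: "n = Suc m" "u \<in> uverts G - (A \<union> B)" "col (insert u A)"
    "reach m (insert u A) B"
    using stuck_reachE[OF assms(1,3,5,6)] by blast
  \<comment> \<open>A single step cannot suffice: \<open>insert u A\<close> contains
    \<open>u\<close>, which is not in \<open>B\<close>.\<close>
  obtain m' where m': "m = Suc m'" using u by (cases m) auto
  then obtain T where T: "reach m' (insert u A) T" "tar_adj G c k T B"
    using u(4) by (meson relpowp_Suc_E)
  have "tar_adj G c k B T" using T(2) tar_adj_commute by blast
  then show thesis
  proof (cases rule: tar_adjE)
    case (1 v)
    then have "col (insert v B)" using T by (auto simp: tar_adj_def)
    moreover from this have "v \<in> uverts G - (A \<union> B)"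
      using 1 assms(4) unfolding stuck_def colorable_set_iff by blast
    moreover from calculation have "card (sym_diff (insert u A) (insert v B)) \<le> m'"
      using card_sym_diff_le_reach T 1 by blast
    ultimately show thesis using that u m' by blast
  next
    case (2 v)
    then have "card T < card B" using finite_col assms by (metis card_Diff1_less)
    then show thesis using T assms by (auto simp: tar_adj_def stuck_def)
  qed
qed

lemma reach_both_insert:
  assumes "col A" "col B" "card A = k" "card B = k"
    and "u \<notin> A" "v \<notin> B" "col (insert u A)" "col (insert v B)"
  shows "reach (card (sym_diff (insert u A) (insert v B)) + 2) A B"
proof -
  have fin: "finite A" "finite B" using finite_col assms by auto
  have "reach (card (sym_diff (insert u A) (insert v B))) (insert u A) (insert v B)"
    using assms fin by (intro reach_of_less_card) auto
  then have "reach (card (sym_diff (insert u A) (insert v B))) (insert v B) (insert u A)"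
    by (rule relpowp_tar_adj_commute)
  then have "reach (Suc (card (sym_diff (insert u A) (insert v B)))) B (insert u A)"
    using reach_insert[of B v] assms by simp
  then have "reach (Suc (card (sym_diff (insert u A) (insert v B)))) (insert u A) B"
    by (rule relpowp_tar_adj_commute)
  then show ?thesis using reach_insert[of A u] assms by simp
qed

lemma card_sym_diff_insert_insert:
  assumes "finite A" "finite B" "u \<notin> A \<union> B" "v \<notin> A \<union> B"
  shows "card (sym_diff (insert u A) (insert v B)) =
    card (sym_diff A B) + (if u = v then 0 else 2)"
proof (cases "u = v")
  case True
  then have "sym_diff (insert u A) (insert v B) = sym_diff A B" using assms by blast
  then show ?thesis using True by simp
next
  case False
  then have "sym_diff (insert u A) (insert v B) = insert u (insert v (sym_diff A B))"
    using assms by blast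
  then show ?thesis using False assms by simp
qed

text \<open>Both subcases at once: \<open>u = v\<close> is a shared outside vertex, which never has
  to be deleted. With \<open>u\<close> and \<open>v\<close> different, the last hypothesis rules out
  any shared vertex, and two further steps are due.\<close>

lemma tar_dist_both_stuck:
  assumes "col A" "col B" "A \<noteq> B" "stuck A B" "stuck B A"
    and "u \<in> uverts G - (A \<union> B)" "v \<in> uverts G - (A \<union> B)" "col (insert u A)" "col (insert v B)"
    and "u \<noteq> v \<Longrightarrow> \<not> (\<exists>w\<in>uverts G - (A \<union> B). col (insert w A) \<and> col (insert w B))"
  shows "tar_dist G c k A B = enat (card (sym_diff A B) + (if u = v then 2 else 4))"
proof (rule tar_dist_eqI)
  have fin: "finite A" "finite B" using finite_col assms by auto
  note eq = card_sym_diff_insert_insert[OF fin]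
  show "reach (card (sym_diff A B) + (if u = v then 2 else 4)) A B"
    using reach_both_insert[of A B u v] eq[of u v] assms
    by (auto simp: stuck_def eval_nat_numeral)
  fix n assume "reach n A B"
  then obtain m u' v' where *: "n = Suc (Suc m)"
    "u' \<in> uverts G - (A \<union> B)" "v' \<in> uverts G - (A \<union> B)" "col (insert u' A)" "col (insert v' B)"
    "card (sym_diff (insert u' A) (insert v' B)) \<le> m"
    by (rule stuck_reach_stuckE[OF assms(1,2,4,5,3)])
  \<comment> \<open>If the given sequence uses one vertex at both ends, that vertex is shared, which
    the last hypothesis allows only for \<open>u = v\<close>. In all other cases \<open>u'\<close>
    and \<open>v'\<close> differ and the bound with 4 holds.\<close>
  have "u = v" if "u' = v'" using that assms(10) * by blast
  then show "card (sym_diff A B) + (if u = v then 2 else 4) \<le> n"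
    using * eq[of u' v'] by (auto split: if_splits)
qed (rule assms)

end

theorem theorem7:
  fixes G :: "'a ugraph" and c k :: nat and S S' :: "'a set"
  assumes "finite_simple_graph G" and "interval_graph G"
    and "c \<ge> 1"
    and "colorable_set G c S" and "colorable_set G c S'" and "S \<noteq> S'"
    and "card S \<ge> k" and "card S' \<ge> k"
    and "\<not> locked G c k S" and "\<not> locked G c k S'"
  defines "H \<equiv> induced_subgraph G (S \<union> S')"
  shows
    "(\<not> locked H c k S \<and> \<not> locked H c k S' \<longrightarrow>
        tar_dist G c k S S' = enat (card (sym_diff S S'))) \<and>
     ((locked H c k S \<and> \<not> locked H c k S') \<or> (\<not> locked H c k S \<and> locked H c k S') \<longrightarrow>
        tar_dist G c k S S' = enat (card (sym_diff S S') + 2)) \<and>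
     (locked H c k S \<and> locked H c k S' \<longrightarrow>
        ((\<exists>v \<in> uverts G - (S \<union> S'). colorable_set G c (S \<union> {v}) \<and> colorable_set G c (S' \<union> {v})) \<longrightarrow>
           tar_dist G c k S S' = enat (card (sym_diff S S') + 2)) \<and>
        (\<not> (\<exists>v \<in> uverts G - (S \<union> S'). colorable_set G c (S \<union> {v}) \<and> colorable_set G c (S' \<union> {v})) \<longrightarrow>
           tar_dist G c k S S' = enat (card (sym_diff S S') + 4)))"
proof -
  interpret finite_interval_graph G c k
    using assms by unfold_locales (auto simp: finite_simple_graph_def)
  have lockedS: "locked H c k S \<longleftrightarrow> stuck S S'"
    unfolding H_def stuck_def using assms by (intro locked_induced_subgraph_iff)
  have lockedS': "locked H c k S' \<longleftrightarrow> stuck S' S"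
    unfolding H_def stuck_def Un_commute[of S] using assms by (intro locked_induced_subgraph_iff)
  \<comment> \<open>Stuckness already fixes the cardinality at \<open>k\<close>, so not being locked
    in \<open>G\<close> can only mean that \<open>A\<close> is not maximal in
    \<open>G\<close>.\<close>
  have ext: "\<exists>v\<in>uverts G - A. col (insert v A)" if "stuck A B" "col A" "\<not> locked G c k A" for A B
    using that locked_iff[of G c A k] by (auto simp: stuck_def)
  have sd: "card (sym_diff S' S) = card (sym_diff S S')" by (rule card_sym_diff_commute)
  have c0: "tar_dist G c k S S' = enat (card (sym_diff S S'))" if "\<not> stuck S S'" "\<not> stuck S' S"
  proof (rule tar_dist_eqI)
    show "reach (card (sym_diff S S')) S S'"
      using that assms by (intro reach_card_sym_diff) (auto simp: stuck_def)
  qed (use card_sym_diff_le_reach assms in blast)+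
  have c1: "tar_dist G c k S S' = enat (card (sym_diff S S') + 2)"
    if st: "stuck S S'" "\<not> stuck S' S"
  proof -
    obtain v where "v \<in> uverts G - S" "col (insert v S)"
      using ext[of S S'] st assms by blast
    then show ?thesis using tar_dist_one_stuck[of S S' v] st assms by blast
  qed
  have c1': "tar_dist G c k S S' = enat (card (sym_diff S S') + 2)"
    if st: "\<not> stuck S S'" "stuck S' S"
  proof -
    obtain v where "v \<in> uverts G - S'" "col (insert v S')"
      using ext[of S' S] st assms by blast
    then have "tar_dist G c k S' S = enat (card (sym_diff S' S) + 2)"
      using tar_dist_one_stuck[of S' S v] st assms by blast
    then show ?thesis using tar_dist_commute assms sd by metis
  qed
  have c2: "tar_dist G c k S S' = enat (card (sym_diff S S') + 2)"
    if st: "stuck S S'" "stuck S' S"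
      and ex: "\<exists>v \<in> uverts G - (S \<union> S'). col (S \<union> {v}) \<and> col (S' \<union> {v})"
  proof -
    obtain v where "v \<in> uverts G - (S \<union> S')" "col (insert v S)" "col (insert v S')"
      using ex by auto
    then show ?thesis using tar_dist_both_stuck[of S S' v v] st assms by simp
  qed
  have c4: "tar_dist G c k S S' = enat (card (sym_diff S S') + 4)"
    if st: "stuck S S'" "stuck S' S"
      and nex: "\<not> (\<exists>v \<in> uverts G - (S \<union> S'). col (S \<union> {v}) \<and> col (S' \<union> {v}))"
  proof -
    \<comment> \<open>The vertex from \<open>ext\<close> avoids \<open>S'\<close> as well, because
      \<open>S\<close> is stuck with respect to \<open>S'\<close>.\<close>
    obtain u where u: "u \<in> uverts G - (S \<union> S')" "col (insert u S)"
      using ext[of S S'] st assms by (auto simp: stuck_def)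
    obtain v where v: "v \<in> uverts G - (S \<union> S')" "col (insert v S')"
      using ext[of S' S] st assms by (auto simp: stuck_def)
    have nex': "\<not> (\<exists>w\<in>uverts G - (S \<union> S'). col (insert w S) \<and> col (insert w S'))"
      using nex by simp
    then have "u \<noteq> v" using u v by blast
    then show ?thesis using tar_dist_both_stuck[of S S' u v] u v nex' st assms by simp
  qed
  show ?thesis unfolding lockedS lockedS' using c0 c1 c1' c2 c4 by blast
qed

end
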